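(* Let $d_{\mathfrak a},n$ be positive integers, and let $d_1,\ldots,d_n,t_1,\ldots,t_n$ be indeterminates. The eigenvalues of the product of matrices $$M_{d_{\mathfrak a}}(d_1,t_1)\cdot M_{d_{\mathfrak a}}(d_2,t_2)\cdots M_{d_{\mathfrak a}}(d_n,t_n)$$ are $\prod_{j=1}^n\lambda_{d_{\mathfrak a}}(d_j,i)$, $i=0,1,\ldots,d_{\mathfrak a}-1$, where $\lambda_{d_{\mathfrak a}}(d,i):=(-1)^{d_{\mathfrak a}+i+1}\binom{d_{\mathfrak a}+d-1}{i}$.
   Context: For $k\in\mathbb{Z}$ and $x$ a number or polynomial, $\binom{x}{k}=\frac{x(x-1)\cdots(x-k+1)}{k!}$ if $k\ge 0$ and $\binom{x}{k}=0$ if $k<0$. For a positive integer $d_{\mathfrak a}$ and indeterminates $d,t$, $M_{d_{\mathfrak a}}(d,t)$ is the $d_{\mathfrak a}\times d_{\mathfrak a}$ matrix with entries polynomials in $d$ and $t$ given by $$M_{d_{\mathfrak a}}(d,t):=\left(\binom{d_{\mathfrak a}+i+t-j-1}{d_{\mathfrak a}-j-1}\binom{d-i-t+j-1}{j}\right)_{0\le i,j\le d_{\mathfrak a}-1}.$$ (For non-negative integers $t$ the first factor equals $\binom{d_{\mathfrak a}+i+t-j-1}{i+t}$.) Eigenvalues are taken over the field of rational functions in the indeterminates. *)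

theory Defs
  imports
    "HOL-Library.Poly_Mapping"
    "HOL-Computational_Algebra.Fraction_Field"
    "Jordan_Normal_Form.Char_Poly"
begin

instance fract :: ("{idom, ring_char_0}") ring_char_0
proof
  show "inj (of_nat :: nat \<Rightarrow> 'a fract)"
    by (rule injI) (simp add: of_nat_fract eq_fract)
qed

instance fract :: ("{idom, ring_char_0}") field_char_0 ..

text \<open>
  The field of rational functions over \<open>'k\<close> in the indeterminates \<open>'v\<close>, as the fraction field of
  the multivariate polynomial ring. The linear order on \<open>'v\<close> has no mathematical significance:
  \<^theory>\<open>HOL-Library.Poly_Mapping\<close> needs it to show that there are no zero divisors.
\<close>

type_synonym ('v, 'k) ratfun = "(('v \<Rightarrow>\<^sub>0 nat) \<Rightarrow>\<^sub>0 'k) fract"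

definition indet :: "'v :: linorder \<Rightarrow> ('v, 'k :: field_char_0) ratfun" where
  "indet v = Fract (Poly_Mapping.single (Poly_Mapping.single v 1) 1) 1"

text \<open>
  Every lower index of a binomial coefficient below is non-negative (\<open>j < da\<close> in the matrix),
  so the truncated subtraction \<open>da - j - 1\<close> on \<^typ>\<open>nat\<close> is exact. All subtractions in upper
  indices take place in the field.
\<close>

definition M :: "nat \<Rightarrow> 'a :: field_char_0 \<Rightarrow> 'a \<Rightarrow> 'a mat" where
  "M da d t = mat da da (\<lambda>(i, j).
     ((of_nat da + of_nat i + t - of_nat j - 1) gchoose (da - j - 1)) *
     ((d - of_nat i - t + of_nat j - 1) gchoose j))"

definition lam :: "nat \<Rightarrow> 'a :: field_char_0 \<Rightarrow> nat \<Rightarrow> 'a" where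
  "lam da d i = (- 1) ^ (da + i + 1) * ((of_nat da + d - 1) gchoose i)"

definition M_prod :: "nat \<Rightarrow> nat \<Rightarrow> (nat \<Rightarrow> 'a :: field_char_0) \<Rightarrow> (nat \<Rightarrow> 'a) \<Rightarrow> 'a mat" where
  "M_prod da n d t = foldr (*) (map (\<lambda>j. M da (d j) (t j)) [1..<Suc n]) (1\<^sub>m da)"

end

theory Submission
  imports Defs "HOL-Computational_Algebra.Formal_Power_Series"
begin

text \<open>
  All matrices \<open>M da d t\<close> become upper triangular in one basis, independent of \<open>d\<close> and \<open>t\<close>.
  View column vectors as functions of the row index and take the basis \<open>i \<mapsto> i gchoose k\<close>. By
  trinomial revision and the Vandermonde convolution, \<open>M da d t\<close> maps the \<open>k\<close>-th basis vector to
  \<open>i \<mapsto> (-1)\<^sup>k (da + d - 1 gchoose da - 1 - k) (i + t - d gchoose k)\<close>, a polynomial in \<open>i\<close> of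
  degree \<open>k\<close>, whose expansion in the basis has the \<open>k\<close>-th coefficient \<open>lam da d (da - 1 - k)\<close>.
  Hence the eigenvalues of a product are the products of the diagonal entries.
\<close>

definition binom_mat :: "nat \<Rightarrow> 'a :: field_char_0 mat" where
  "binom_mat n = mat n n (\<lambda>(i, k). of_nat i gchoose k)"

text \<open>Column \<open>k\<close> lists the coordinates of the image of the \<open>k\<close>-th
  basis vector: Vandermonde applied to \<open>i + (t - d)\<close> splits off the factors
  \<open>i gchoose l\<close>.\<close>

definition tri_mat :: "nat \<Rightarrow> 'a :: field_char_0 \<Rightarrow> 'a \<Rightarrow> 'a mat" where
  "tri_mat n d t = mat n n (\<lambda>(l, k). if l \<le> k
     then (- 1) ^ k * ((of_nat n + d - 1) gchoose (n - 1 - k)) * ((t - d) gchoose (k - l)) else 0)"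

lemma binom_mat_carrier [simp]: "binom_mat n \<in> carrier_mat n n"
  by (simp add: binom_mat_def)

lemma tri_mat_carrier [simp]: "tri_mat n d t \<in> carrier_mat n n"
  by (simp add: tri_mat_def)

lemma M_carrier [simp]: "M n d t \<in> carrier_mat n n"
  by (simp add: M_def)

lemma det_binom_mat: "det (binom_mat n :: 'a :: field_char_0 mat) = 1"
proof -
  have "det (binom_mat n :: 'a mat) = prod_list (diag_mat (binom_mat n))"
  proof (rule det_lower_triangular)
    fix i j assume "i < j" "j < n"
    then show "(binom_mat n :: 'a mat) $$ (i, j) = 0"
      by (simp add: binom_mat_def flip: binomial_gbinomial)
  qed simp
  also have "\<dots> = 1"
    unfolding prod_list_diag_prod
    by (rule prod.neutral) (auto simp: binom_mat_def simp flip: binomial_gbinomial)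
  finally show ?thesis .
qed

text \<open>Negating both upper indices frees them of \<open>j\<close>. The row-by-column sum over
  \<open>j\<close> then has the shape of a Vandermonde convolution.\<close>

lemma M_entry:
  fixes d t :: "'a :: field_char_0"
  assumes "i < n" "j < n"
  shows "M n d t $$ (i, j) = (- 1) ^ (n - 1) *
    ((- (of_nat i + t + 1)) gchoose (n - 1 - j)) * ((of_nat i + t - d) gchoose j)"
proof -
  have [simp]: "n - Suc 0 - j = n - Suc j"
    by simp
  have "(of_nat n + of_nat i + t - of_nat j - 1) gchoose (n - j - 1) =
      (- 1) ^ (n - j - 1) * ((- (of_nat i + t + 1)) gchoose (n - j - 1))"
    by (subst gbinomial_negated_upper) (use assms in \<open>simp add: of_nat_diff algebra_simps\<close>)
  moreover have "(d - of_nat i - t + of_nat j - 1) gchoose j =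
      (- 1) ^ j * ((of_nat i + t - d) gchoose j)"
    by (subst gbinomial_negated_upper) (simp add: algebra_simps)
  moreover have "(- 1 :: 'a) ^ (n - 1) = (- 1) ^ (n - j - 1) * (- 1) ^ j"
    using assms by (simp flip: power_add)
  ultimately show ?thesis
    using assms by (simp add: M_def mult_ac)
qed

text \<open>Trinomial revision turns \<open>(b gchoose j) * (j gchoose k)\<close> into
  \<open>(b gchoose k) * (b - k gchoose j - k)\<close>; after the shift of \<open>j\<close> by
  \<open>k\<close>, ordinary Vandermonde applies.\<close>

lemma gbinomial_weighted_Vandermonde:
  fixes a b :: "'a :: field_char_0"
  assumes "k \<le> m"
  shows "(\<Sum>j=0..m. (a gchoose (m - j)) * (b gchoose j) * (of_nat j gchoose k)) =
    (b gchoose k) * ((a + b - of_nat k) gchoose (m - k))"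
proof -
  have "(\<Sum>j=0..m. (a gchoose (m - j)) * (b gchoose j) * (of_nat j gchoose k)) =
      (\<Sum>j=k..m. (a gchoose (m - j)) * (b gchoose j) * (of_nat j gchoose k))"
    by (rule sum.mono_neutral_right) (auto simp flip: binomial_gbinomial)
  also have "\<dots> = (\<Sum>j=k..m. (b gchoose k) * (((b - of_nat k) gchoose (j - k)) * (a gchoose (m - j))))"
    by (rule sum.cong) (auto simp: gbinomial_trinomial_revision mult.assoc mult.left_commute)
  also have "\<dots> = (\<Sum>j=0..m-k. (b gchoose k) * (((b - of_nat k) gchoose j) * (a gchoose (m - k - j))))"
    using assms
    by (intro sum.reindex_bij_witness[of _ "\<lambda>j. j + k" "\<lambda>j. j - k"]) auto
  also have "\<dots> = (b gchoose k) * ((b - of_nat k + a) gchoose (m - k))"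
    by (simp only: gbinomial_Vandermonde flip: sum_distrib_left)
  finally show ?thesis
    by (simp add: algebra_simps)
qed

lemma M_mult_binom_mat: "M n d t * binom_mat n = binom_mat n * tri_mat n d t"
proof (rule eq_matI)
  fix i k
  assume "i < dim_row (binom_mat n * tri_mat n d t)" "k < dim_col (binom_mat n * tri_mat n d t)"
  then have i: "i < n" and k: "k < n"
    by (simp_all add: binom_mat_def tri_mat_def)
  define m where "m = n - 1"
  have n: "{0..<n} = {0..m}" and km: "k \<le> m" and nm: "of_nat n = of_nat m + (1 :: 'a)"
    using k by (auto simp: m_def of_nat_diff)
  have "(M n d t * binom_mat n) $$ (i, k) =
      (\<Sum>j=0..<n. M n d t $$ (i, j) * binom_mat n $$ (j, k))"
    using i k by (simp add: scalar_prod_def M_def binom_mat_def)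
  also have "\<dots> = (- 1) ^ m * (\<Sum>j=0..m. ((- (of_nat i + t + 1)) gchoose (m - j)) *
      ((of_nat i + t - d) gchoose j) * (of_nat j gchoose k))"
    unfolding sum_distrib_left n[symmetric]
    by (rule sum.cong) (use i k in \<open>simp_all add: M_entry binom_mat_def m_def mult.assoc\<close>)
  also have "\<dots> = (- 1) ^ m * (((of_nat i + t - d) gchoose k) *
      ((- d - 1 - of_nat k) gchoose (m - k)))"
  proof -
    \<comment> \<open>Both \<open>i\<close> and \<open>t\<close> cancel here, so the row index
      survives only in a factor of degree \<open>k\<close>. This is what forces
      triangularity.\<close>
    have "- (of_nat i + t + 1) + (of_nat i + t - d) - of_nat k = - d - 1 - of_nat k"
      by simp
    then show ?thesis
      by (simp only: gbinomial_weighted_Vandermonde[OF km])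
  qed
  also have "(- d - 1 - of_nat k) gchoose (m - k) =
      (- 1) ^ (m - k) * ((of_nat n + d - 1) gchoose (m - k))"
    \<comment> \<open>The negated upper index is \<open>(m - k) + d + 1 + k - 1 = m + d\<close>,
      that is \<open>n + d - 1\<close>.\<close>
    by (subst gbinomial_negated_upper) (use km in \<open>simp add: nm of_nat_diff algebra_simps\<close>)
  also have "(- 1) ^ m * (((of_nat i + t - d) gchoose k) *
      ((- 1) ^ (m - k) * ((of_nat n + d - 1) gchoose (m - k)))) =
      (- 1) ^ k * ((of_nat n + d - 1) gchoose (m - k)) * ((of_nat i + (t - d)) gchoose k)"
  proof -
    have "m + (m - k) = k + 2 * (m - k)"
      using km by simp
    then have "(- 1 :: 'a) ^ (m + (m - k)) = (- 1) ^ k"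
      by (simp only: power_add power_mult) simp
    then have "(- 1 :: 'a) ^ m * (- 1) ^ (m - k) = (- 1) ^ k"
      by (simp only: power_add)
    then show ?thesis
      by (simp add: mult_ac add_diff_eq)
  qed
  also have "\<dots> = (\<Sum>l=0..k. (of_nat i gchoose l) *
      ((- 1) ^ k * ((of_nat n + d - 1) gchoose (m - k)) * ((t - d) gchoose (k - l))))"
    by (subst gbinomial_Vandermonde[symmetric]) (simp add: sum_distrib_left mult_ac)
  also have "\<dots> = (\<Sum>l=0..k. binom_mat n $$ (i, l) * tri_mat n d t $$ (l, k))"
    by (rule sum.cong) (use i k in \<open>simp_all add: binom_mat_def tri_mat_def m_def\<close>)
  \<comment> \<open>The added terms have \<open>l > k\<close>, where \<open>tri_mat\<close>
    vanishes.\<close>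
  also have "\<dots> = (\<Sum>l=0..<n. binom_mat n $$ (i, l) * tri_mat n d t $$ (l, k))"
    by (rule sum.mono_neutral_left) (use k in \<open>auto simp: tri_mat_def\<close>)
  also have "\<dots> = (binom_mat n * tri_mat n d t) $$ (i, k)"
    using i k by (simp add: scalar_prod_def tri_mat_def binom_mat_def)
  finally show "(M n d t * binom_mat n) $$ (i, k) = (binom_mat n * tri_mat n d t) $$ (i, k)" .
qed (simp_all add: M_def binom_mat_def tri_mat_def)

lemma upper_triangular_tri_mat: "upper_triangular (tri_mat n d t)"
  by (auto simp: tri_mat_def)

text \<open>On the diagonal the factor involving \<open>t - d\<close> is \<open>gchoose 0\<close>,
  hence 1, and the two signs have exponents of equal parity. The eigenvalues appear in reversed
  order.\<close>

lemma tri_mat_diag: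
  assumes "k < n"
  shows "tri_mat n d t $$ (k, k) = lam n d (n - 1 - k)"
proof -
  have "n + (n - 1 - k) + 1 = k + 2 * (n - k)"
    using assms by simp
  then have "(- 1 :: 'a) ^ (n + (n - 1 - k) + 1) = (- 1) ^ k"
    by (simp only: power_add power_mult) simp
  then show ?thesis
    using assms by (simp add: tri_mat_def lam_def)
qed

text \<open>A term \<open>A $$ (i, l) * B $$ (l, j)\<close> can be nonzero only for
  \<open>i \<le> l \<le> j\<close>; for \<open>i = j\<close> this leaves the single term
  \<open>l = i\<close>.\<close>

lemma
  fixes A B :: "'a :: semiring_0 mat"
  assumes A: "A \<in> carrier_mat n n" "upper_triangular A"
    and B: "B \<in> carrier_mat n n" "upper_triangular B"
  shows upper_triangular_mult: "upper_triangular (A * B)"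
    and upper_triangular_mult_diag: "k < n \<Longrightarrow> (A * B) $$ (k, k) = A $$ (k, k) * B $$ (k, k)"
proof -
  have entry: "(A * B) $$ (i, j) = (\<Sum>l=0..<n. A $$ (i, l) * B $$ (l, j))" if "i < n" "j < n" for i j
    using that A(1) B(1) by (simp add: scalar_prod_def)
  have zero: "A $$ (i, l) * B $$ (l, j) = 0" if "i < n" "l < n" "l < i \<or> j < l" for i j l
    using that upper_triangularD[OF A(2), of l i] upper_triangularD[OF B(2), of j l] A(1) B(1)
    by auto
  show "upper_triangular (A * B)"
  proof (rule upper_triangularI)
    fix i j assume "j < i" "i < dim_row (A * B)"
    then show "(A * B) $$ (i, j) = 0"
      using A(1) by (subst entry) (auto intro!: sum.neutral zero)
  qed
  assume k: "k < n"
  have "(\<Sum>l=0..<n. A $$ (k, l) * B $$ (l, k)) = (\<Sum>l\<in>{k}. A $$ (k, l) * B $$ (l, k))"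
    using k by (intro sum.mono_neutral_right) (auto intro!: zero)
  then show "(A * B) $$ (k, k) = A $$ (k, k) * B $$ (k, k)"
    using k by (simp add: entry)
qed

text \<open>An arbitrary list \<open>js\<close> permits induction on the factors. Triangularity is
  stated as an intertwining relation, so no inverse of \<open>binom_mat\<close> enters the
  induction.\<close>

lemma M_foldr_triangularisation:
  fixes d t :: "'b \<Rightarrow> 'a :: field_char_0"
  shows "\<exists>U \<in> carrier_mat n n. upper_triangular U
    \<and> foldr (*) (map (\<lambda>j. M n (d j) (t j)) js) (1\<^sub>m n) \<in> carrier_mat n n
    \<and> foldr (*) (map (\<lambda>j. M n (d j) (t j)) js) (1\<^sub>m n) * binom_mat n = binom_mat n * U
    \<and> (\<forall>k<n. U $$ (k, k) = (\<Prod>j\<leftarrow>js. lam n (d j) (n - 1 - k)))"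
proof (induction js)
  case Nil
  show ?case
    by (rule bexI[of _ "1\<^sub>m n"])
      (auto simp: left_mult_one_mat[OF binom_mat_carrier] right_mult_one_mat[OF binom_mat_carrier])
next
  case (Cons j js)
  let ?P = "foldr (*) (map (\<lambda>j. M n (d j) (t j)) js) (1\<^sub>m n)"
  let ?M = "M n (d j) (t j)" and ?T = "tri_mat n (d j) (t j)" and ?B = "binom_mat n :: 'a mat"
  obtain U where U: "U \<in> carrier_mat n n" "upper_triangular U" "?P \<in> carrier_mat n n"
    "?P * ?B = ?B * U" "\<forall>k<n. U $$ (k, k) = (\<Prod>j\<leftarrow>js. lam n (d j) (n - 1 - k))"
    using Cons.IH by blast
  \<comment> \<open>\<open>?B\<close> moves leftwards past one factor at a time, turning
    \<open>?P\<close> into \<open>U\<close> and then \<open>?M\<close> into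
    \<open>?T\<close>.\<close>
  have "?M * ?P * ?B = ?M * (?B * U)"
    unfolding U(4)[symmetric] by (rule assoc_mult_mat[OF M_carrier U(3) binom_mat_carrier])
  also have "\<dots> = ?M * ?B * U"
    by (rule assoc_mult_mat[OF M_carrier binom_mat_carrier U(1), symmetric])
  also have "\<dots> = ?B * (?T * U)"
    unfolding M_mult_binom_mat by (rule assoc_mult_mat[OF binom_mat_carrier tri_mat_carrier U(1)])
  finally show ?case
    using U upper_triangular_mult[OF tri_mat_carrier upper_triangular_tri_mat U(1,2)]
      mult_carrier_mat[OF M_carrier U(3)] mult_carrier_mat[OF tri_mat_carrier U(1)]
    by (intro bexI[of _ "?T * U"])
      (auto simp: upper_triangular_mult_diag[OF tri_mat_carrier upper_triangular_tri_mat U(1,2)]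
        tri_mat_diag)
qed

lemma char_poly_eq_if_intertwined:
  fixes A B P :: "'a :: field mat"
  assumes A: "A \<in> carrier_mat n n" and B: "B \<in> carrier_mat n n" and P: "P \<in> carrier_mat n n"
    and "det P \<noteq> 0" and AP: "A * P = P * B"
  shows "char_poly A = char_poly B"
proof (rule char_poly_similar)
  obtain Q where Q: "Q \<in> carrier_mat n n" "Q * P = 1\<^sub>m n" "P * Q = 1\<^sub>m n"
    \<comment> \<open>The \<open>()\<close> fills the irrelevant extension slot of the ring record
      \<open>ring_mat\<close>.\<close>
    using det_non_zero_imp_unit[OF P \<open>det P \<noteq> 0\<close>, of "()"]
    by (auto simp: Units_def ring_mat_def)
  have "P * B * Q = A * (P * Q)"
    unfolding AP[symmetric] by (rule assoc_mult_mat) (use A P Q in auto)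
  then have "A = P * B * Q"
    using A Q by simp
  then show "similar_mat A B"
    unfolding similar_mat_def similar_mat_wit_def Let_def using A B P Q by blast
qed

text \<open>The matrix is similar to a triangular \<open>U\<close>, whose diagonal gives the linear
  factors. This is an identity for arbitrary field values of \<open>d\<close> and
  \<open>t\<close>.\<close>

lemma char_poly_M_prod:
  fixes d t :: "nat \<Rightarrow> 'a :: field_char_0"
  shows "char_poly (M_prod da n d t) = (\<Prod>i=0..<da. [:- (\<Prod>j=1..n. lam da (d j) i), 1:])"
proof -
  obtain U where U: "U \<in> carrier_mat da da" "upper_triangular U"
    "M_prod da n d t \<in> carrier_mat da da"
    "M_prod da n d t * binom_mat da = binom_mat da * U"
    "\<forall>k<da. U $$ (k, k) = (\<Prod>j\<leftarrow>[1..<Suc n]. lam da (d j) (da - 1 - k))"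
    using M_foldr_triangularisation[of da d t "[1..<Suc n]"] unfolding M_prod_def by blast
  have prod_upt: "(\<Prod>j\<leftarrow>[1..<Suc n]. f j) = (\<Prod>j=1..n. f j)" for f :: "nat \<Rightarrow> 'a"
    by (simp only: atLeastLessThanSuc_atLeastAtMost set_upt distinct_upt
        flip: prod.distinct_set_conv_list)
  have "char_poly (M_prod da n d t) = char_poly U"
    using char_poly_eq_if_intertwined[OF U(3,1) binom_mat_carrier _ U(4)] by (simp add: det_binom_mat)
  also have "\<dots> = (\<Prod>k=0..<da. [:- (U $$ (k, k)), 1:])"
    using U(1) by (simp add: char_poly_upper_triangular[OF U(1,2)] diag_mat_def o_def
        flip: prod.distinct_set_conv_list)
  also have "\<dots> = (\<Prod>k=0..<da. [:- (\<Prod>j=1..n. lam da (d j) (da - 1 - k)), 1:])"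
    by (rule prod.cong) (use U(5) prod_upt in auto)
  \<comment> \<open>The reversal \<open>k \<mapsto> da - 1 - k\<close> is an involution on the index
    range.\<close>
  also have "\<dots> = (\<Prod>i=0..<da. [:- (\<Prod>j=1..n. lam da (d j) i), 1:])"
    by (rule prod.reindex_bij_witness[of _ "\<lambda>k. da - 1 - k" "\<lambda>k. da - 1 - k"]) auto
  finally show ?thesis .
qed

text \<open>The eigenvalues are the roots of the characteristic polynomial; its factorisation also
  records their algebraic multiplicities.\<close>

theorem theorem2:
  fixes da n :: nat
    and u w :: "nat \<Rightarrow> 'v :: linorder"
    and d t :: "nat \<Rightarrow> ('v, 'k :: field_char_0) ratfun"
  assumes "da \<ge> 1" and "n \<ge> 1"
    and "distinct (map u [1..<Suc n] @ map w [1..<Suc n])"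
    and "\<forall>j \<in> {1..n}. d j = indet (u j)"
    and "\<forall>j \<in> {1..n}. t j = indet (w j)"
  shows "{x. eigenvalue (M_prod da n d t) x} = (\<lambda>i. \<Prod>j=1..n. lam da (d j) i) ` {0..<da}
    \<and> char_poly (M_prod da n d t) = (\<Prod>i=0..<da. [:- (\<Prod>j=1..n. lam da (d j) i), 1:])"
proof
  have "M_prod da n d t \<in> carrier_mat da da"
    using M_foldr_triangularisation[of da d t "[1..<Suc n]"] unfolding M_prod_def by blast
  then have "eigenvalue (M_prod da n d t) x \<longleftrightarrow> (\<exists>i\<in>{0..<da}. x = (\<Prod>j=1..n. lam da (d j) i))" for x
    by (simp add: eigenvalue_root_char_poly char_poly_M_prod poly_prod)
  then show "{x. eigenvalue (M_prod da n d t) x} = (\<lambda>i. \<Prod>j=1..n. lam da (d j) i) ` {0..<da}"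
    by blast
qed (rule char_poly_M_prod)

end
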